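(* Let $K$ be a field, let $P\subset\mathbb{Z}_+^n$ be a discrete polymatroid on $[n]$, and let $\mathcal{P}=\operatorname{conv}(P)\subset\mathbb{R}_+^n$. Then $K[P]=K[\mathcal{P}]$. In particular, $K[P]$ is normal.
   Context: $[n]=\{1,\dots,n\}$; $\mathbb{R}_+^n$, $\mathbb{Z}_+^n$ are the real, respectively integer, vectors with nonnegative entries. $|u|=\sum_iu(i)$. $u\le v$ is the componentwise order; $u<v$ means $u\le v$, $u\neq v$; $u\vee v$ is the componentwise maximum. A discrete polymatroid on $[n]$ is a nonempty finite set $P\subset\mathbb{Z}_+^n$ such that (D1) if $u\in P$, $v\in\mathbb{Z}_+^n$ and $v\le u$, then $v\in P$; (D2) if $u,v\in P$ with $|v|>|u|$, then there is $w\in P$ with $u<w\le u\vee v$. For $u\in\mathbb{Z}_+^n$ let $t^u=t_1^{u(1)}\cdots t_n^{u(n)}$, with $t_1,\dots,t_n,s$ indeterminates over $K$. $K[P]=K[t^us : u\in P]\subset K[t_1,\dots,t_n,s]$. The Ehrhart ring of $\mathcal{P}$ is the $K$-subalgebra $K[\mathcal{P}]\subset K[t_1,\dots,t_n,s]$ generated by the monomials $t^us^i$ with $(u,i)\in\mathcal{C}\cap\mathbb{Z}^{n+1}$, where $\mathcal{C}=\mathbb{R}_+\{(p,1): p\in\mathcal{P}\}\subset\mathbb{R}^{n+1}$ is the cone over $\mathcal{P}$. Normal means integrally closed in its field of fractions. *)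

theory Defs
  imports
    "HOL-Analysis.Analysis"
    "HOL-Library.Poly_Mapping"
    "HOL-Library.Option_ord"
    "HOL-Computational_Algebra.Polynomial_Factorial"
begin

section \<open>Discrete polymatroids\<close>

text \<open>
  Vectors in \<open>\<int>\<^sub>+\<^sup>n\<close> have type \<^typ>\<open>nat^'n\<close>, where \<open>'n\<close> plays the role of \<open>[n]\<close>. The library order
  on vectors is the componentwise one, with \<open>u < v\<close> meaning \<open>u \<le> v\<close> and \<open>u \<noteq> v\<close>.
\<close>

definition modulus :: "nat^'n \<Rightarrow> nat" where
  "modulus u = (\<Sum>i\<in>UNIV. u $ i)"

definition join :: "nat^'n \<Rightarrow> nat^'n \<Rightarrow> nat^'n" where
  "join u v = (\<chi> i. max (u $ i) (v $ i))"

definition discrete_polymatroid :: "(nat^'n) set \<Rightarrow> bool" where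
  "discrete_polymatroid P \<longleftrightarrow>
     P \<noteq> {} \<and> finite P \<and>
     (\<forall>u\<in>P. \<forall>v. v \<le> u \<longrightarrow> v \<in> P) \<and>
     (\<forall>u\<in>P. \<forall>v\<in>P. modulus v > modulus u \<longrightarrow> (\<exists>w\<in>P. u < w \<and> w \<le> join u v))"

definition real_vec :: "nat^'n \<Rightarrow> real^'n" where
  "real_vec u = (\<chi> i. real (u $ i))"


section \<open>The polynomial ring \<open>K[t\<^sub>1, \<dots>, t\<^sub>n, s]\<close> and its subalgebras\<close>

text \<open>
  The indeterminates are indexed by \<^typ>\<open>'n option\<close>: \<open>Some j\<close> stands for \<open>t\<^sub>j\<close> and \<open>None\<close> for \<open>s\<close>.
  A polynomial is a finitely supported function from exponent vectors to coefficients. The library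
  provides the integral domain structure, which the fraction field requires, only for linearly
  ordered index types; this is why \<open>'n\<close> is taken to be linearly ordered, like \<open>[n]\<close>.
\<close>

type_synonym ('n, 'k) ts_poly = "('n option \<Rightarrow>\<^sub>0 nat) \<Rightarrow>\<^sub>0 'k"

definition const :: "'k::field \<Rightarrow> ('n, 'k) ts_poly" where
  "const c = Poly_Mapping.single 0 c"

definition indet :: "'n option \<Rightarrow> ('n, 'k::field) ts_poly" where
  "indet x = Poly_Mapping.single (Poly_Mapping.single x 1) 1"

definition ts_monom :: "nat^'n \<Rightarrow> nat \<Rightarrow> ('n, 'k::field) ts_poly" where
  "ts_monom u i = (\<Prod>j\<in>UNIV. indet (Some j) ^ (u $ j)) * indet None ^ i"

definition is_subalgebra :: "('n, 'k::field) ts_poly set \<Rightarrow> bool" where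
  "is_subalgebra A \<longleftrightarrow>
     range const \<subseteq> A \<and> (\<forall>f\<in>A. \<forall>g\<in>A. f + g \<in> A) \<and> (\<forall>f\<in>A. \<forall>g\<in>A. f * g \<in> A)"

definition generated_subalgebra :: "('n, 'k::field) ts_poly set \<Rightarrow> ('n, 'k) ts_poly set" where
  "generated_subalgebra G = is_subalgebra hull G"

definition polymatroid_ring :: "(nat^'n) set \<Rightarrow> ('n, 'k::field) ts_poly set" where
  "polymatroid_ring P = generated_subalgebra {ts_monom u 1 | u. u \<in> P}"

definition cone_over :: "(real^'n) set \<Rightarrow> ((real^'n) \<times> real) set" where
  "cone_over Q = {r *\<^sub>R (p, 1) | r p. r \<ge> 0 \<and> p \<in> Q}"

text \<open>
  Only for \<open>Q \<subseteq> \<real>\<^sub>+\<^sup>n\<close>: then every lattice point of the cone has nonnegative entries, so that nothing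
  is lost by letting \<open>u\<close> and \<open>i\<close> range over natural numbers.
\<close>

definition ehrhart_ring :: "(real^'n) set \<Rightarrow> ('n, 'k::field) ts_poly set" where
  "ehrhart_ring Q = generated_subalgebra {ts_monom u i | u i. (real_vec u, real i) \<in> cone_over Q}"


section \<open>Normality\<close>

text \<open>
  For a subring \<open>A\<close> of an integral domain \<open>R\<close>, the field of fractions of \<open>A\<close> is realised inside that
  of \<open>R\<close>, and \<open>A\<close> is identified with its image under \<^const>\<open>to_fract\<close>.
\<close>

definition fraction_field_of :: "'r::idom set \<Rightarrow> 'r fract set" where
  "fraction_field_of A = {to_fract a / to_fract b | a b. a \<in> A \<and> b \<in> A \<and> b \<noteq> 0}"

definition integral_over :: "'r::idom set \<Rightarrow> 'r fract \<Rightarrow> bool" where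
  "integral_over A x \<longleftrightarrow>
     (\<exists>p :: 'r poly. lead_coeff p = 1 \<and> (\<forall>i. coeff p i \<in> A) \<and> poly (map_poly to_fract p) x = 0)"

definition normal_subring :: "'r::idom set \<Rightarrow> bool" where
  "normal_subring A \<longleftrightarrow> (\<forall>x\<in>fraction_field_of A. integral_over A x \<longrightarrow> x \<in> to_fract ` A)"

end

theory Submission
  imports Defs
begin

text \<open>
  Let \<open>\<rho> A\<close> be the largest value of \<open>u A = (\<Sum>j\<in>A. u $ j)\<close> over \<open>u \<in> P\<close>. Both rings turn out to be the
  span of the monomials \<open>t\<^sup>u s\<^sup>i\<close> with \<open>u A \<le> i \<rho> A\<close> for all \<open>A\<close>; the exponents \<open>(u, i)\<close> of this kind
  form the monoid \<open>rank_monoid P\<close>. Each of these inequalities is linear and holds on \<open>P\<close>, hence on the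
  cone over its convex hull, so \<open>K[P] \<subseteq> K[conv P] \<subseteq> K[rank_monoid P]\<close> is immediate. The circle closes
  by \<open>integer_decomposition\<close>: if \<open>u A \<le> i \<rho> A\<close> for all \<open>A\<close>, then \<open>u\<close> is a sum of \<open>i\<close> elements of \<open>P\<close>.

  The decomposition rests on two facts. First, the exchange axiom makes \<open>\<rho>\<close> submodular and makes \<open>P\<close>
  exactly the set of lattice points satisfying \<open>u A \<le> \<rho> A\<close> (\<open>mem_polymatroid_iff\<close>). Second, a
  nonnegative integer vector \<open>u\<close> with \<open>u A \<le> f A + g A\<close>, where \<open>f\<close> and \<open>g\<close> are integer valued, monotone
  and submodular, is the sum of nonnegative integer vectors bounded by \<open>f\<close> and by \<open>g\<close>
  (\<open>polymatroid_splitting\<close>, a form of the discrete sandwich theorem). With \<open>f = \<rho>\<close> and \<open>g = (i - 1) \<rho>\<close>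
  it splits off one element of \<open>P\<close> at a time.

  For normality, a fraction \<open>a / b\<close> that is integral over \<open>K[S]\<close> is almost integral: some \<open>d \<noteq> 0\<close> has
  \<open>d (a / b)\<^sup>k \<in> K[S]\<close> for every \<open>k\<close>. With \<open>lm\<close> the leading exponent for a monomial well-order, this says
  that \<open>lm d + k (lm a - lm b)\<close> lies in \<open>S\<close> for all \<open>k\<close>. As \<open>S = rank_monoid P\<close> is cut out of the
  lattice by homogeneous linear inequalities, letting \<open>k\<close> grow gives \<open>\<gamma> = lm a - lm b \<in> S\<close>. Let \<open>m\<close> be the
  monomial of exponent \<open>\<gamma>\<close>; subtracting from \<open>a\<close> a scalar multiple of \<open>m b\<close> kills its leading term,
  preserves almost integrality, and changes the fraction by an element of \<open>K[S]\<close>. By induction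
  along the well-order, \<open>b\<close> divides \<open>a\<close> within \<open>K[S]\<close>.
\<close>

section \<open>Leading exponents\<close>

lemma poly_mapping_sum_singles:
  "f = (\<Sum>k\<in>Poly_Mapping.keys f. Poly_Mapping.single k (Poly_Mapping.lookup f k))"
  by (rule poly_mapping_eqI)
    (auto simp: lookup_sum lookup_single when_def in_keys_iff sum.delta)

lemma lookup_mult_keys:
  fixes f g :: "'e::comm_monoid_add \<Rightarrow>\<^sub>0 'k::comm_semiring_1"
  shows "Poly_Mapping.lookup (f * g) e =
    (\<Sum>a\<in>Poly_Mapping.keys f. \<Sum>b\<in>Poly_Mapping.keys g.
       if a + b = e then Poly_Mapping.lookup f a * Poly_Mapping.lookup g b else 0)"
proof -
  have "f * g = (\<Sum>a\<in>Poly_Mapping.keys f. Poly_Mapping.single a (Poly_Mapping.lookup f a)) *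
      (\<Sum>b\<in>Poly_Mapping.keys g. Poly_Mapping.single b (Poly_Mapping.lookup g b))"
    by (metis poly_mapping_sum_singles)
  also have "\<dots> = (\<Sum>a\<in>Poly_Mapping.keys f. \<Sum>b\<in>Poly_Mapping.keys g.
      Poly_Mapping.single (a + b) (Poly_Mapping.lookup f a * Poly_Mapping.lookup g b))"
    by (simp add: sum_product mult_single)
  finally show ?thesis
    by (simp add: lookup_sum lookup_single when_def)
qed

definition lead_exp :: "('e::linorder \<Rightarrow>\<^sub>0 'k::zero) \<Rightarrow> 'e" where
  "lead_exp f = Max (Poly_Mapping.keys f)"

lemma lead_exp_in_keys: "f \<noteq> 0 \<Longrightarrow> lead_exp f \<in> Poly_Mapping.keys f"
  unfolding lead_exp_def by (rule Max_in) (auto simp: poly_mapping_eq_iff fun_eq_iff in_keys_iff)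

lemma le_lead_exp: "e \<in> Poly_Mapping.keys f \<Longrightarrow> e \<le> lead_exp f"
  unfolding lead_exp_def by simp

text \<open>
  The order on exponents is compatible with addition, so the sum of the two leading exponents arises
  from no other pair of exponents: no cancellation can occur there.
\<close>

lemma lookup_mult_lead:
  fixes f g :: "'e::{ordered_cancel_comm_monoid_add,linorder} \<Rightarrow>\<^sub>0 'k::field"
  assumes "f \<noteq> 0" "g \<noteq> 0"
  shows "Poly_Mapping.lookup (f * g) (lead_exp f + lead_exp g) =
    Poly_Mapping.lookup f (lead_exp f) * Poly_Mapping.lookup g (lead_exp g)"
proof -
  have eq: "a = lead_exp f \<and> b = lead_exp g"
    if "a \<in> Poly_Mapping.keys f" "b \<in> Poly_Mapping.keys g" "a + b = lead_exp f + lead_exp g" for a b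
  proof -
    have "a \<le> lead_exp f" "b \<le> lead_exp g"
      using that by (auto intro: le_lead_exp)
    then show ?thesis
      using that(3) add_less_le_mono[of a "lead_exp f" b "lead_exp g"]
        add_le_less_mono[of a "lead_exp f" b "lead_exp g"]
      by (metis less_irrefl order_le_less)
  qed
  have "Poly_Mapping.lookup (f * g) (lead_exp f + lead_exp g) =
    (\<Sum>a\<in>Poly_Mapping.keys f. \<Sum>b\<in>Poly_Mapping.keys g.
       if a = lead_exp f \<and> b = lead_exp g
       then Poly_Mapping.lookup f a * Poly_Mapping.lookup g b else 0)"
    unfolding lookup_mult_keys using eq by (intro sum.cong refl) auto
  also have "\<dots> = (\<Sum>a\<in>Poly_Mapping.keys f. if a = lead_exp f then
      Poly_Mapping.lookup f a * Poly_Mapping.lookup g (lead_exp g) else 0)"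
    using lead_exp_in_keys[OF assms(2)] by (intro sum.cong refl) (auto simp: sum.delta)
  also have "\<dots> = Poly_Mapping.lookup f (lead_exp f) * Poly_Mapping.lookup g (lead_exp g)"
    using lead_exp_in_keys[OF assms(1)] by (simp add: sum.delta)
  finally show ?thesis .
qed

lemma lead_exp_mult:
  fixes f g :: "'e::{ordered_cancel_comm_monoid_add,linorder} \<Rightarrow>\<^sub>0 'k::field"
  assumes "f \<noteq> 0" "g \<noteq> 0"
  shows "lead_exp (f * g) = lead_exp f + lead_exp g"
proof (rule antisym)
  have "f * g \<noteq> 0"
    using assms by simp
  then obtain a b where "a \<in> Poly_Mapping.keys f" "b \<in> Poly_Mapping.keys g" "lead_exp (f * g) = a + b"
    using lead_exp_in_keys[of "f * g"] keys_mult[of f g] by blast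
  then show "lead_exp (f * g) \<le> lead_exp f + lead_exp g"
    by (simp add: add_mono le_lead_exp)
  have "lead_exp f + lead_exp g \<in> Poly_Mapping.keys (f * g)"
    using lookup_mult_lead[OF assms] lead_exp_in_keys[OF assms(1)] lead_exp_in_keys[OF assms(2)]
    by (simp add: in_keys_iff)
  then show "lead_exp f + lead_exp g \<le> lead_exp (f * g)"
    by (rule le_lead_exp)
qed

text \<open>
  Iterated addition stands for adding \<open>k\<close> times the exponent, as a general commutative monoid has no
  scalar multiplication by natural numbers.
\<close>

lemma lead_exp_mult_power:
  fixes d a :: "'e::{ordered_cancel_comm_monoid_add,linorder} \<Rightarrow>\<^sub>0 'k::field"
  assumes "d \<noteq> 0" "a \<noteq> 0"
  shows "lead_exp (d * a ^ k) = ((+) (lead_exp a) ^^ k) (lead_exp d)"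
proof (induction k)
  case (Suc k)
  have "lead_exp (d * a ^ Suc k) = lead_exp (a * (d * a ^ k))"
    by (simp add: mult_ac)
  also have "\<dots> = lead_exp a + lead_exp (d * a ^ k)"
    using assms by (intro lead_exp_mult) auto
  finally show ?case
    using Suc by simp
qed simp

text \<open>
  One step of long division: \<open>c\<close> and \<open>\<gamma>\<close> are chosen so that the leading terms of \<open>a\<close> and of the
  subtracted multiple of \<open>b\<close> agree.
\<close>

lemma lead_exp_cancel:
  fixes a b :: "'e::{ordered_cancel_comm_monoid_add,linorder} \<Rightarrow>\<^sub>0 'k::field"
  assumes "a \<noteq> 0" "b \<noteq> 0" and \<gamma>: "lead_exp a = \<gamma> + lead_exp b"
    and c: "c = Poly_Mapping.lookup a (lead_exp a) / Poly_Mapping.lookup b (lead_exp b)"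
    and nz: "a - Poly_Mapping.single \<gamma> c * b \<noteq> 0"
  shows "lead_exp (a - Poly_Mapping.single \<gamma> c * b) < lead_exp a"
proof -
  let ?m = "Poly_Mapping.single \<gamma> c"
  have lb: "Poly_Mapping.lookup b (lead_exp b) \<noteq> 0" and la: "Poly_Mapping.lookup a (lead_exp a) \<noteq> 0"
    using assms(1,2) lead_exp_in_keys by (auto simp: in_keys_iff)
  then have "c \<noteq> 0"
    using c by simp
  then have lm: "lead_exp ?m = \<gamma>" and m: "?m \<noteq> 0"
    by (auto simp: lead_exp_def poly_mapping_eq_iff fun_eq_iff lookup_single when_def)
  have eq: "lead_exp (?m * b) = lead_exp a"
    using lead_exp_mult[OF m \<open>b \<noteq> 0\<close>] lm \<gamma> by simp
  have "Poly_Mapping.lookup (?m * b) (lead_exp a) = Poly_Mapping.lookup a (lead_exp a)"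
    using lookup_mult_lead[OF m \<open>b \<noteq> 0\<close>] lm \<gamma> c lb by simp
  then have "lead_exp a \<notin> Poly_Mapping.keys (a - ?m * b)"
    by (simp add: in_keys_iff lookup_minus)
  moreover have "lead_exp (a - ?m * b) \<in> Poly_Mapping.keys (a - ?m * b)"
    using nz by (rule lead_exp_in_keys)
  moreover from this have "lead_exp (a - ?m * b) \<le> lead_exp a"
    using keys_diff[of a "?m * b"] le_lead_exp[of _ a] le_lead_exp[of _ "?m * b"] eq by auto
  ultimately show ?thesis
    by (metis order_le_less)
qed

section \<open>Integral and almost integral fractions\<close>

lemma sum_closed:
  assumes "0 \<in> A" "\<And>x y. x \<in> A \<Longrightarrow> y \<in> A \<Longrightarrow> x + y \<in> A" "\<And>i. i \<in> I \<Longrightarrow> f i \<in> A"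
  shows "sum f I \<in> A"
  using assms(3) by (induction I rule: infinite_finite_induct) (auto intro: assms)

lemma power_closed:
  assumes "1 \<in> A" "\<And>x y. x \<in> A \<Longrightarrow> y \<in> A \<Longrightarrow> x * y \<in> A" "x \<in> A"
  shows "x ^ (k::nat) \<in> (A :: 'a::monoid_mult set)"
  by (induction k) (auto intro: assms)

lemma to_fract_sum: "to_fract (sum f I) = (\<Sum>i\<in>I. to_fract (f i))"
  by (induction I rule: infinite_finite_induct) auto

lemma to_fract_power: "to_fract (x ^ k) = to_fract x ^ k"
  by (induction k) auto

text \<open>
  If \<open>y = a / b\<close> satisfies a monic equation of degree \<open>m\<close>, then \<open>d = b\<^sup>m\<close> is a common denominator of all
  powers of \<open>y\<close>: it clears the powers up to the \<open>m\<close>-th one, and the equation expresses every higher power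
  through lower ones with coefficients in \<open>A\<close>.
\<close>

lemma integral_imp_almost_integral:
  fixes A :: "'r::idom set"
  assumes one: "1 \<in> A" and add: "\<And>x y. x \<in> A \<Longrightarrow> y \<in> A \<Longrightarrow> x + y \<in> A"
    and mult: "\<And>x y. x \<in> A \<Longrightarrow> y \<in> A \<Longrightarrow> x * y \<in> A" and neg: "\<And>x. x \<in> A \<Longrightarrow> - x \<in> A"
    and a: "a \<in> A" and b: "b \<in> A" "b \<noteq> 0"
    and int: "integral_over A (to_fract a / to_fract b)"
  obtains d where "d \<in> A" "d \<noteq> 0" "\<And>k. \<exists>c\<in>A. d * a ^ k = c * b ^ k"
proof -
  define y where "y = to_fract a / to_fract b"
  obtain p where p: "lead_coeff p = 1" "\<And>i. coeff p i \<in> A" "poly (map_poly to_fract p) y = 0"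
    using int by (auto simp: integral_over_def y_def)
  define m where "m = degree p"
  have zero: "0 \<in> A"
    using add[OF one neg[OF one]] by simp
  note pow = power_closed[of A, OF one mult]
  have "0 = (\<Sum>i\<le>m. to_fract (coeff p i) * y ^ i)"
    using p(3) by (simp add: poly_altdef degree_map_poly coeff_map_poly m_def)
  also have "\<dots> = y ^ m + (\<Sum>i<m. to_fract (coeff p i) * y ^ i)"
    using p(1) by (simp add: lessThan_Suc_atMost[symmetric] m_def)
  finally have ym: "y ^ m = - (\<Sum>i<m. to_fract (coeff p i) * y ^ i)"
    by (simp add: eq_neg_iff_add_eq_0)
  have *: "\<exists>c\<in>A. to_fract (b ^ m) * y ^ k = to_fract c" for k
  proof (induction k rule: less_induct)
    case (less k)
    show ?case
    proof (cases "k \<le> m")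
      case True
      then have "b ^ m = b ^ (m - k) * b ^ k"
        by (simp flip: power_add)
      then have "to_fract (b ^ m) * y ^ k = to_fract (b ^ (m - k) * a ^ k)"
        using b by (simp add: y_def power_divide to_fract_power)
      then show ?thesis
        using a b by (metis mult pow)
    next
      case False
      have "\<exists>c. i < m \<longrightarrow> c \<in> A \<and> to_fract (b ^ m) * y ^ (k - m + i) = to_fract c" for i
      proof (cases "i < m")
        case True
        then have "k - m + i < k"
          using False by linarith
        then show ?thesis
          using less by blast
      qed simp
      then obtain c where c: "\<And>i. i < m \<Longrightarrow> c i \<in> A"
        "\<And>i. i < m \<Longrightarrow> to_fract (b ^ m) * y ^ (k - m + i) = to_fract (c i)"
        by metis
      have "y ^ k = y ^ (k - m) * y ^ m"
        using False by (simp flip: power_add)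
      then have "to_fract (b ^ m) * y ^ k
          = - (\<Sum>i<m. to_fract (coeff p i) * (to_fract (b ^ m) * y ^ (k - m + i)))"
        by (simp add: ym sum_distrib_left power_add mult_ac)
      also have "\<dots> = - (\<Sum>i<m. to_fract (coeff p i) * to_fract (c i))"
        using c(2) by (intro arg_cong[of _ _ uminus] sum.cong) auto
      also have "\<dots> = to_fract (- (\<Sum>i<m. coeff p i * c i))"
        by (simp add: to_fract_sum)
      finally show ?thesis
        using c(1) p(2) by (auto intro!: bexI[of _ "- (\<Sum>i<m. coeff p i * c i)"] neg sum_closed zero add mult)
    qed
  qed
  show thesis
  proof
    show "b ^ m \<in> A" "b ^ m \<noteq> 0"
      using pow b by auto
    fix k
    obtain c where c: "c \<in> A" "to_fract (b ^ m) * y ^ k = to_fract c"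
      using * by blast
    have "to_fract (b ^ m * a ^ k) = to_fract (b ^ m) * y ^ k * to_fract (b ^ k)"
      using b by (simp add: y_def power_divide to_fract_power)
    then have "to_fract (b ^ m * a ^ k) = to_fract (c * b ^ k)"
      using c by simp
    then show "\<exists>c\<in>A. b ^ m * a ^ k = c * b ^ k"
      using c(1) by (auto simp del: to_fract_mult)
  qed
qed

section \<open>Normality of monoid algebras\<close>

definition monoid_algebra :: "'e set \<Rightarrow> ('e \<Rightarrow>\<^sub>0 'k::zero) set" where
  "monoid_algebra S = {f. Poly_Mapping.keys f \<subseteq> S}"

lemma monoid_algebra_add:
  "f \<in> monoid_algebra S \<Longrightarrow> g \<in> monoid_algebra S \<Longrightarrow> f + g \<in> monoid_algebra S"
  using Poly_Mapping.keys_add[of f g] by (auto simp: monoid_algebra_def)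

lemma monoid_algebra_uminus:
  "f \<in> monoid_algebra S \<Longrightarrow> - f \<in> (monoid_algebra S :: ('e \<Rightarrow>\<^sub>0 'k::ab_group_add) set)"
  by (auto simp: monoid_algebra_def in_keys_iff)

lemma monoid_algebra_mult:
  assumes "\<And>x y. x \<in> S \<Longrightarrow> y \<in> S \<Longrightarrow> x + y \<in> S" "f \<in> monoid_algebra S" "g \<in> monoid_algebra S"
  shows "f * g \<in> monoid_algebra S"
  using assms keys_mult[of f g] unfolding monoid_algebra_def by blast

lemma monoid_algebra_single: "s \<in> S \<Longrightarrow> Poly_Mapping.single s c \<in> monoid_algebra S"
  by (simp add: monoid_algebra_def)

text \<open>
  Subtracting an element \<open>m\<close> of \<open>A\<close> from the fraction \<open>a / b\<close> keeps the same common denominator \<open>d\<close>: expand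
  the powers by the binomial theorem.
\<close>

lemma almost_integral_diff:
  fixes A :: "'r::idom set"
  assumes one: "1 \<in> A" and add: "\<And>x y. x \<in> A \<Longrightarrow> y \<in> A \<Longrightarrow> x + y \<in> A"
    and mult: "\<And>x y. x \<in> A \<Longrightarrow> y \<in> A \<Longrightarrow> x * y \<in> A" and neg: "\<And>x. x \<in> A \<Longrightarrow> - x \<in> A"
    and m: "m \<in> A" and d: "\<And>k. \<exists>c\<in>A. d * a ^ k = c * b ^ k"
  shows "\<exists>c\<in>A. d * (a - m * b) ^ k = c * b ^ k"
proof -
  obtain c where c: "\<And>i. c i \<in> A" "\<And>i. d * a ^ i = c i * b ^ i"
    using d by metis
  have zero: "0 \<in> A"
    using add[OF one neg[OF one]] by simp
  have nat: "of_nat n \<in> A" for n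
    by (induction n) (auto intro: zero one add)
  let ?c = "\<Sum>i\<le>k. of_nat (k choose i) * (c i * (- m) ^ (k - i))"
  have "d * (a - m * b) ^ k = d * (a + (- m * b)) ^ k"
    by simp
  also have "\<dots> = (\<Sum>i\<le>k. of_nat (k choose i) * ((d * a ^ i) * (- m * b) ^ (k - i)))"
    unfolding binomial_ring sum_distrib_left by (simp add: mult_ac)
  also have "\<dots> = (\<Sum>i\<le>k. of_nat (k choose i) * (c i * (- m) ^ (k - i)) * b ^ k)"
  proof (intro sum.cong refl)
    fix i assume "i \<in> {..k}"
    then have "b ^ k = b ^ i * b ^ (k - i)"
      by (simp flip: power_add)
    then show "of_nat (k choose i) * ((d * a ^ i) * (- m * b) ^ (k - i)) =
        of_nat (k choose i) * (c i * (- m) ^ (k - i)) * b ^ k"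
      unfolding c(2) power_mult_distrib by (simp only: mult_ac)
  qed
  also have "\<dots> = ?c * b ^ k"
    by (simp add: sum_distrib_right)
  finally have "d * (a - m * b) ^ k = ?c * b ^ k" .
  moreover have "?c \<in> A"
    using c m by (intro sum_closed zero add mult nat power_closed[of A, OF one mult] neg)
  ultimately show ?thesis
    by blast
qed

text \<open>
  The hypothesis \<open>closed\<close> is complete integral closedness of the monoid \<open>S\<close>, stated without subtraction: if
  \<open>s + k (\<alpha> - \<beta>)\<close> lies in \<open>S\<close> for all \<open>k\<close>, then so does \<open>\<alpha> - \<beta>\<close>. It is applied to the leading exponents of
  \<open>d\<close>, \<open>a\<close> and \<open>b\<close>, where \<open>d\<close> is a common denominator of the powers of \<open>a / b\<close>, and it supplies the leading term
  of the quotient; the well-founded order makes the division terminate.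
\<close>

theorem normal_monoid_algebra:
  fixes S :: "'e::{ordered_cancel_comm_monoid_add,linorder} set"
  assumes wf: "wf {(x, y :: 'e). x < y}"
    and zero: "0 \<in> S" and add: "\<And>x y. x \<in> S \<Longrightarrow> y \<in> S \<Longrightarrow> x + y \<in> S"
    and closed: "\<And>s \<alpha> \<beta>. \<lbrakk>s \<in> S; \<alpha> \<in> S; \<beta> \<in> S; \<And>k. \<exists>c\<in>S. ((+) \<alpha> ^^ k) s = ((+) \<beta> ^^ k) c\<rbrakk>
      \<Longrightarrow> \<exists>\<gamma>\<in>S. \<alpha> = \<gamma> + \<beta>"
  shows "normal_subring (monoid_algebra S :: ('e \<Rightarrow>\<^sub>0 'k::field) set)"
proof -
  let ?A = "monoid_algebra S :: ('e \<Rightarrow>\<^sub>0 'k) set"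
  have one: "1 \<in> ?A"
    using zero by (simp add: monoid_algebra_def)
  have Aadd: "f + g \<in> ?A" if "f \<in> ?A" "g \<in> ?A" for f g
    using that by (rule monoid_algebra_add)
  have Aneg: "- f \<in> ?A" if "f \<in> ?A" for f
    using that by (rule monoid_algebra_uminus)
  have Amult: "f * g \<in> ?A" if "f \<in> ?A" "g \<in> ?A" for f g
    using add that by (rule monoid_algebra_mult)
  have lead: "lead_exp f \<in> S" if "f \<in> ?A" "f \<noteq> 0" for f
    using that lead_exp_in_keys by (auto simp: monoid_algebra_def)
  have divides: "\<exists>q\<in>?A. a = q * b"
    if d: "d \<in> ?A" "d \<noteq> 0" and b: "b \<in> ?A" "b \<noteq> 0" and "a \<in> ?A"
      and "\<And>k. \<exists>c\<in>?A. d * a ^ k = c * b ^ k" for a b d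
    using that(5,6)
  proof (induction "lead_exp a" arbitrary: a rule: wf_induct_rule[OF wf])
    case (1 a)
    show ?case
    proof (cases "a = 0")
      case True
      have "0 \<in> ?A"
        by (simp add: monoid_algebra_def)
      with True show ?thesis
        by (intro bexI[of _ 0]) auto
    next
      case False
      have "\<exists>c\<in>S. ((+) (lead_exp a) ^^ k) (lead_exp d) = ((+) (lead_exp b) ^^ k) c" for k
      proof -
        obtain c where c: "c \<in> ?A" "d * a ^ k = c * b ^ k"
          using "1.prems"(2) by blast
        have "c \<noteq> 0"
          using c(2) d False by auto
        then show ?thesis
          using c lead_exp_mult_power[OF d(2) False, of k] lead_exp_mult_power[OF \<open>c \<noteq> 0\<close> b(2), of k]
            lead by force
      qed
      then obtain \<gamma> where \<gamma>: "\<gamma> \<in> S" "lead_exp a = \<gamma> + lead_exp b"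
        using closed[of "lead_exp d" "lead_exp a" "lead_exp b"] lead d b "1.prems"(1) False by blast
      define m where "m = Poly_Mapping.single \<gamma>
        (Poly_Mapping.lookup a (lead_exp a) / Poly_Mapping.lookup b (lead_exp b))"
      have m: "m \<in> ?A"
        unfolding m_def using \<gamma>(1) by (rule monoid_algebra_single)
      have a': "a - m * b \<in> ?A"
        using Aadd[OF "1.prems"(1) Aneg[OF Amult[OF m b(1)]]] by simp
      have "\<exists>q\<in>?A. a - m * b = q * b"
      proof (cases "a - m * b = 0")
        case True
        have "0 \<in> ?A"
          by (simp add: monoid_algebra_def)
        with True show ?thesis
          by (intro bexI[of _ 0]) auto
      next
        case nz: False
        show ?thesis
        proof (rule "1.hyps"[OF _ a'])
          show "(lead_exp (a - m * b), lead_exp a) \<in> {(x, y). x < y}"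
            using lead_exp_cancel[OF False b(2) \<gamma>(2) refl] nz by (simp add: m_def)
          show "\<exists>c\<in>?A. d * (a - m * b) ^ k = c * b ^ k" for k
            by (rule almost_integral_diff[OF one Aadd Amult Aneg m "1.prems"(2)])
        qed
      qed
      then obtain q where "q \<in> ?A" "a - m * b = q * b"
        by blast
      then show ?thesis
        using m by (intro bexI[of _ "q + m"] Aadd) (auto simp: algebra_simps)
    qed
  qed
  show ?thesis
    unfolding normal_subring_def
  proof (intro ballI impI)
    fix x assume "x \<in> fraction_field_of ?A" and int: "integral_over ?A x"
    then obtain a b where x: "x = to_fract a / to_fract b" and ab: "a \<in> ?A" "b \<in> ?A" "b \<noteq> 0"
      by (auto simp: fraction_field_of_def)
    obtain d where "d \<in> ?A" "d \<noteq> 0" "\<And>k. \<exists>c\<in>?A. d * a ^ k = c * b ^ k"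
      using integral_imp_almost_integral[OF one Aadd Amult Aneg ab int[unfolded x]] by blast
    then obtain q where "q \<in> ?A" "a = q * b"
      using divides[of d b a] ab by blast
    then show "x \<in> to_fract ` ?A"
      using x ab by auto
  qed
qed

text \<open>
  The order is lexicographic with the smallest index most significant, so the proof adds indices from
  the largest downwards: each new index takes precedence over those already treated, and the order grows
  into a lexicographic product with the order on \<open>\<nat>\<close>.
\<close>

lemma wf_lex_poly_mapping: "wf {(x, y :: 'a::{finite,linorder} \<Rightarrow>\<^sub>0 nat). x < y}"
proof -
  define R where "R A = {(f, g :: 'a \<Rightarrow> nat). \<exists>k\<in>A. f k < g k \<and> (\<forall>k'\<in>A. k' < k \<longrightarrow> f k' = g k')}" for A
  have "wf (R A)" if "finite A" for A
    using that
  proof (induction A rule: finite_linorder_min_induct)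
    case empty
    then show ?case
      by (simp add: R_def)
  next
    case (insert b A)
    have "R (insert b A) \<subseteq> inv_image (less_than <*lex*> R A) (\<lambda>f. (f b, f))"
      using insert.hyps by (auto simp: R_def dest: order.asym)
    then show ?case
      using insert.IH by (meson wf_inv_image wf_less_than wf_lex_prod wf_subset)
  qed
  then have "wf (inv_image (R UNIV) Poly_Mapping.lookup)"
    by (intro wf_inv_image) simp
  then show ?thesis
    by (rule wf_subset) (auto simp: R_def less_poly_mapping.rep_eq less_fun_def)
qed


section \<open>Splitting a vector between two submodular bounds\<close>

definition polymatroid_function :: "('a set \<Rightarrow> int) \<Rightarrow> bool" where
  "polymatroid_function f \<longleftrightarrow> f {} = 0 \<and> mono f \<and> (\<forall>A B. f (A \<union> B) + f (A \<inter> B) \<le> f A + f B)"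

text \<open>
  The reduced function bounds the vectors on the other indices once the value \<open>x\<close> has been assigned to
  index \<open>j\<close>: if \<open>v\<close> has \<open>v j = x\<close> and is bounded by \<open>f\<close>, then its sum over \<open>A\<close> not containing \<open>j\<close> is at
  most \<open>f A\<close> and at most \<open>f (insert j A) - x\<close>.
\<close>

lemma polymatroid_function_reduce:
  assumes f: "polymatroid_function f" and x: "0 \<le> x" "x \<le> f {j}"
  shows "polymatroid_function (\<lambda>A. min (f A) (f (insert j A) - x))"
proof -
  have mono: "\<And>A B. A \<subseteq> B \<Longrightarrow> f A \<le> f B" and sub: "\<And>A B. f (A \<union> B) + f (A \<inter> B) \<le> f A + f B"
    and empty: "f {} = 0"
    using f by (auto simp: polymatroid_function_def mono_def)
  let ?f = "\<lambda>A. min (f A) (f (insert j A) - x)"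
  have mixed: "?f (A \<union> B) + ?f (A \<inter> B) \<le> f A + (f (insert j B) - x)" for A B
  proof (cases "j \<in> A")
    case True
    then have "A \<union> insert j B = A \<union> B" "A \<inter> insert j B = insert j (A \<inter> B)"
      by auto
    then show ?thesis
      using sub[of A "insert j B"] by simp
  next
    case False
    then have "A \<union> insert j B = insert j (A \<union> B)" "A \<inter> insert j B = A \<inter> B"
      by auto
    then show ?thesis
      using sub[of A "insert j B"] by simp
  qed
  have "?f (A \<union> B) + ?f (A \<inter> B) \<le> ?f A + ?f B" for A B
  proof -
    have "?f (A \<union> B) + ?f (A \<inter> B) \<le> f A + f B"
      using sub[of A B] by simp
    moreover have "?f (A \<union> B) + ?f (A \<inter> B) \<le> (f (insert j A) - x) + (f (insert j B) - x)"
      using sub[of "insert j A" "insert j B"] by (simp add: insert_commute)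
    moreover note mixed[of A B] mixed[of B A]
    ultimately show ?thesis
      by (simp add: min_def Un_commute Int_commute split: if_splits)
  qed
  moreover have "?f A \<le> ?f B" if "A \<subseteq> B" for A B
    using mono[OF that] mono[OF insert_mono[OF that, of j]] by (simp add: min_def)
  ultimately show ?thesis
    using x empty by (auto simp: polymatroid_function_def mono_def)
qed

text \<open>
  Induction on the ground set: fix the value \<open>x\<close> of \<open>v\<close> at one index \<open>j\<close> and pass to the reduced
  functions. The bound on \<open>u\<close> survives the reduction as soon as
  \<open>sum u A + u j - f A - g (insert j A) \<le> x \<le> f (insert j B) + g B - sum u B\<close> for all \<open>A\<close> and \<open>B\<close>. Every
  such lower bound lies below every upper bound: apply submodularity of \<open>f\<close> to \<open>A\<close> and \<open>insert j B\<close>, that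
  of \<open>g\<close> to \<open>insert j A\<close> and \<open>B\<close>, and the hypothesis on \<open>u\<close> to \<open>insert j (A \<union> B)\<close> and \<open>A \<inter> B\<close>. The
  bounds are integers, so \<open>x\<close> can be taken integral. Monotonicity makes the choice compatible with
  \<open>0 \<le> x \<le> u j\<close>.
\<close>

theorem polymatroid_splitting:
  fixes u :: "'a \<Rightarrow> int"
  assumes "finite E" "polymatroid_function f" "polymatroid_function g"
    and "\<And>j. j \<in> E \<Longrightarrow> 0 \<le> u j" and "\<And>A. A \<subseteq> E \<Longrightarrow> sum u A \<le> f A + g A"
  shows "\<exists>v. (\<forall>j\<in>E. 0 \<le> v j \<and> v j \<le> u j) \<and>
    (\<forall>A\<subseteq>E. sum v A \<le> f A \<and> sum (\<lambda>j. u j - v j) A \<le> g A)"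
  using assms
proof (induction E arbitrary: f g rule: finite_induct)
  case empty
  then show ?case
    by (auto simp: polymatroid_function_def)
next
  case (insert j E)
  have f: "\<And>A B. A \<subseteq> B \<Longrightarrow> f A \<le> f B" "\<And>A B. f (A \<union> B) + f (A \<inter> B) \<le> f A + f B" "f {} = 0"
    and g: "\<And>A B. A \<subseteq> B \<Longrightarrow> g A \<le> g B" "\<And>A B. g (A \<union> B) + g (A \<inter> B) \<le> g A + g B" "g {} = 0"
    using insert.prems(1,2) by (auto simp: polymatroid_function_def mono_def)
  note u = insert.prems(4)
  have uj: "0 \<le> u j"
    using insert.prems(3) by simp
  have u_insert: "sum u (insert j A) = u j + sum u A" if "A \<subseteq> E" for A
    using that insert.hyps by (subst sum.insert) (auto intro: finite_subset)
  \<comment> \<open>The least admissible value is chosen.\<close>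
  define l where "l A = sum u A + u j - f A - g (insert j A)" for A
  define x where "x = max 0 (Max (l ` Pow E))"
  have l_le: "l A \<le> x" if "A \<subseteq> E" for A
    using that insert.hyps(1) by (simp add: x_def le_max_iff_disj)
  have x_cases: "x = 0 \<or> (\<exists>B\<subseteq>E. x = l B)"
  proof -
    have "Max (l ` Pow E) \<in> l ` Pow E"
      using insert.hyps(1) by (intro Max_in) auto
    then show ?thesis
      by (auto simp: x_def max_def)
  qed
  have x_le: "x \<le> f (insert j A) + g A - sum u A" if A: "A \<subseteq> E" for A
    using x_cases
  proof (elim disjE exE conjE)
    assume "x = 0"
    then show ?thesis
      using f(1)[of A "insert j A"] u[of A] A by fastforce
  next
    fix B assume B: "B \<subseteq> E" and x: "x = l B"
    have j: "j \<notin> A" "j \<notin> B"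
      using A B insert.hyps(2) by auto
    have fin: "finite A" "finite B"
      using A B insert.hyps(1) finite_subset by auto
    have "insert j A \<union> B = insert j (A \<union> B)" "insert j A \<inter> B = A \<inter> B"
      "A \<union> insert j B = insert j (A \<union> B)" "A \<inter> insert j B = A \<inter> B"
      using j by auto
    then have "f (insert j (A \<union> B)) + f (A \<inter> B) \<le> f (insert j A) + f B"
      "g (insert j (A \<union> B)) + g (A \<inter> B) \<le> g A + g (insert j B)"
      using f(2)[of "insert j A" B] g(2)[of A "insert j B"] by auto
    moreover have "sum u (insert j (A \<union> B)) \<le> f (insert j (A \<union> B)) + g (insert j (A \<union> B))"
      "sum u (A \<inter> B) \<le> f (A \<inter> B) + g (A \<inter> B)"
      using A B by (auto intro!: u)
    moreover have "sum u (insert j (A \<union> B)) + sum u (A \<inter> B) = u j + sum u A + sum u B"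
      using u_insert[of "A \<union> B"] A B sum.union_inter[OF fin, of u] by simp
    ultimately show ?thesis
      by (simp add: x l_def)
  qed
  have x_uj: "x \<le> u j"
    using x_cases
  proof (elim disjE exE conjE)
    fix B assume "B \<subseteq> E" "x = l B"
    then show ?thesis
      using u[of B] g(1)[of B "insert j B"] by (fastforce simp: l_def)
  qed (use uj in simp)
  have x0: "0 \<le> x"
    by (simp add: x_def)
  let ?f = "\<lambda>A. min (f A) (f (insert j A) - x)" and ?g = "\<lambda>A. min (g A) (g (insert j A) - (u j - x))"
  have "\<exists>v. (\<forall>j\<in>E. 0 \<le> v j \<and> v j \<le> u j) \<and> (\<forall>A\<subseteq>E. sum v A \<le> ?f A \<and> sum (\<lambda>j. u j - v j) A \<le> ?g A)"
  proof (rule insert.IH)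
    show "polymatroid_function ?f"
      using x_le[of "{}"] x0 f(3) g(3) by (intro polymatroid_function_reduce insert.prems) auto
    show "polymatroid_function ?g"
      using l_le[of "{}"] x_uj f(3) by (intro polymatroid_function_reduce insert.prems) (auto simp: l_def)
    show "0 \<le> u i" if "i \<in> E" for i
      using insert.prems(3) that by simp
    show "sum u A \<le> ?f A + ?g A" if "A \<subseteq> E" for A
    proof -
      have sub: "A \<subseteq> insert j E" "insert j A \<subseteq> insert j E"
        using that by auto
      have "sum u A \<le> f A + g A"
        by (rule u[OF sub(1)])
      moreover have "sum u A \<le> (f (insert j A) - x) + g A"
        using x_le[OF that] by linarith
      moreover have "sum u A \<le> f A + (g (insert j A) - (u j - x))"
        using l_le[OF that] unfolding l_def by linarith
      moreover have "sum u A \<le> (f (insert j A) - x) + (g (insert j A) - (u j - x))"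
        using u[OF sub(2)] u_insert[OF that] by linarith
      ultimately show ?thesis
        unfolding min_def by presburger
    qed
  qed
  then obtain v where v': "\<forall>i\<in>E. 0 \<le> v i \<and> v i \<le> u i"
    "\<forall>A\<subseteq>E. sum v A \<le> ?f A \<and> sum (\<lambda>j. u j - v j) A \<le> ?g A"
    by (elim exE conjE)
  then have v: "\<And>i. i \<in> E \<Longrightarrow> 0 \<le> v i \<and> v i \<le> u i"
    "\<And>A. A \<subseteq> E \<Longrightarrow> sum v A \<le> ?f A" "\<And>A. A \<subseteq> E \<Longrightarrow> sum (\<lambda>j. u j - v j) A \<le> ?g A"
    by simp_all
  define w where "w = v(j := x)"
  have w: "sum w A = sum v A" "sum (\<lambda>j. u j - w j) A = sum (\<lambda>j. u j - v j) A" if "A \<subseteq> E" for A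
    using that insert.hyps(2) by (auto simp: w_def intro!: sum.cong)
  have "sum w A \<le> f A \<and> sum (\<lambda>j. u j - w j) A \<le> g A" if A: "A \<subseteq> insert j E" for A
  proof (cases "j \<in> A")
    case False
    then have "A \<subseteq> E"
      using A by auto
    then show ?thesis
      using v(2,3)[of A] w by simp
  next
    case True
    define B where "B = A - {j}"
    have B: "B \<subseteq> E" "A = insert j B" "j \<notin> B" "finite B"
      using A True insert.hyps(1) finite_subset[of B E] by (auto simp: B_def)
    have "sum w A = x + sum v B" "sum (\<lambda>j. u j - w j) A = (u j - x) + sum (\<lambda>j. u j - v j) B"
      using B w by (simp_all add: w_def)
    then show ?thesis
      using v(2,3)[OF B(1)] B(2) by simp
  qed
  moreover have "0 \<le> w i \<and> w i \<le> u i" if "i \<in> insert j E" for i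
    using that v(1) x0 x_uj by (auto simp: w_def)
  ultimately show ?case
    by blast
qed


section \<open>The rank function of a discrete polymatroid\<close>

definition weight :: "'n set \<Rightarrow> nat ^ 'n \<Rightarrow> nat" where
  "weight A u = (\<Sum>j\<in>A. u $ j)"

definition polymatroid_rank :: "(nat ^ 'n) set \<Rightarrow> 'n set \<Rightarrow> nat" where
  "polymatroid_rank P A = Max (weight A ` P)"

definition restrict_vec :: "'n set \<Rightarrow> nat ^ 'n \<Rightarrow> nat ^ 'n" where
  "restrict_vec A u = (\<chi> j. if j \<in> A then u $ j else 0)"

lemma restrict_vec_le: "restrict_vec A u \<le> u"
  by (simp add: restrict_vec_def less_eq_vec_def)

lemma modulus_eq_weight: "(\<And>j. j \<notin> A \<Longrightarrow> u $ j = 0) \<Longrightarrow> modulus u = weight A u"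
  unfolding modulus_def weight_def by (rule sum.mono_neutral_right) auto

lemma modulus_restrict_vec: "modulus (restrict_vec A u) = weight A u"
  by (subst modulus_eq_weight[of A]) (auto simp: restrict_vec_def weight_def)

lemma weight_mono: "u \<le> v \<Longrightarrow> weight A u \<le> weight A v"
  by (auto simp: weight_def less_eq_vec_def intro: sum_mono)

lemma weight_strict_mono:
  assumes "u \<le> v" "j \<in> A" "u $ j < v $ j"
  shows "weight A u < weight A v"
  unfolding weight_def using assms
  by (intro sum_strict_mono_ex1) (auto simp: less_eq_vec_def)

lemma modulus_strict_mono:
  assumes "u < v"
  shows "modulus u < modulus v"
proof -
  obtain j where "u $ j < v $ j"
    using assms by (auto simp: less_vec_def less_eq_vec_def not_le)
  then show ?thesis
    using weight_strict_mono[of u v j UNIV] assms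
    by (simp add: less_vec_def weight_def modulus_def)
qed

lemma strict_vecE:
  assumes "u < (v :: nat ^ 'n)"
  obtains j where "u \<le> v" "u $ j < v $ j"
  using assms by (auto simp: less_vec_def less_eq_vec_def not_le)

context
  fixes P :: "(nat ^ 'n) set"
  assumes P: "discrete_polymatroid P"
begin

lemma polymatroid_finite: "finite P" and polymatroid_nonempty: "P \<noteq> {}"
  and polymatroid_downward: "u \<in> P \<Longrightarrow> v \<le> u \<Longrightarrow> v \<in> P"
  using P by (auto simp: discrete_polymatroid_def)

lemma polymatroid_augment:
  assumes "u \<in> P" "x \<in> P" "modulus u < modulus x"
  obtains w where "w \<in> P" "u < w" "w \<le> join u x"
proof -
  have "\<exists>w\<in>P. u < w \<and> w \<le> join u x"
    using P assms by (simp add: discrete_polymatroid_def)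
  then show thesis
    using that by blast
qed

lemma polymatroid_maximal:
  assumes "u \<in> P" "Q u"
  obtains w where "w \<in> P" "Q w" "\<And>v. v \<in> P \<Longrightarrow> Q v \<Longrightarrow> modulus v \<le> modulus w"
proof -
  let ?X = "{w \<in> P. Q w}"
  have X: "finite (modulus ` ?X)" "modulus ` ?X \<noteq> {}"
    using assms polymatroid_finite by auto
  have "Max (modulus ` ?X) \<in> modulus ` ?X"
    using X by (rule Max_in)
  then obtain w where w: "w \<in> ?X" "Max (modulus ` ?X) = modulus w"
    by (rule imageE)
  have "modulus v \<le> modulus w" if "v \<in> P" "Q v" for v
    using Max_ge[OF X(1), of "modulus v"] that w(2) by auto
  then show thesis
    using that[of w] w(1) by blast
qed

text \<open>
  Repeated exchange: a vector between \<open>u\<close> and \<open>join u x\<close> of largest modulus cannot have modulus below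
  that of \<open>x\<close>, since the exchange axiom would enlarge it.
\<close>

lemma polymatroid_augment_fully:
  assumes "u \<in> P" "x \<in> P"
  obtains w where "w \<in> P" "u \<le> w" "w \<le> join u x" "modulus x \<le> modulus w"
proof -
  have "u \<le> u \<and> u \<le> join u x"
    by (simp add: less_eq_vec_def join_def)
  then obtain w where w: "w \<in> P" "u \<le> w" "w \<le> join u x"
      "\<And>v. v \<in> P \<Longrightarrow> u \<le> v \<and> v \<le> join u x \<Longrightarrow> modulus v \<le> modulus w"
    using polymatroid_maximal[of u "\<lambda>w. u \<le> w \<and> w \<le> join u x"] assms(1) by metis
  have "modulus x \<le> modulus w"
  proof (rule ccontr)
    assume "\<not> ?thesis"
    then obtain w' where w': "w' \<in> P" "w < w'" "w' \<le> join w x"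
      using polymatroid_augment[OF w(1) assms(2)] by auto
    have "join w x \<le> join u x"
      using w(3) by (auto simp: less_eq_vec_def join_def)
    then have "u \<le> w' \<and> w' \<le> join u x"
      using w' w(2) by (meson order.trans order.strict_implies_order)
    then show False
      using w(4)[OF w'(1)] modulus_strict_mono[OF w'(2)] by simp
  qed
  then show thesis
    using that w by blast
qed

lemma weight_le_rank: "u \<in> P \<Longrightarrow> weight A u \<le> polymatroid_rank P A"
  unfolding polymatroid_rank_def using polymatroid_finite by simp

lemma rank_attained:
  obtains u where "u \<in> P" "weight A u = polymatroid_rank P A" "\<And>j. j \<notin> A \<Longrightarrow> u $ j = 0"
    "modulus u = polymatroid_rank P A"
proof -
  have "polymatroid_rank P A \<in> weight A ` P"
    unfolding polymatroid_rank_def using polymatroid_finite polymatroid_nonempty by (intro Max_in) auto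
  then obtain u where u: "u \<in> P" "polymatroid_rank P A = weight A u"
    by auto
  show thesis
  proof
    show "restrict_vec A u \<in> P"
      using u(1) restrict_vec_le by (rule polymatroid_downward)
    show "weight A (restrict_vec A u) = polymatroid_rank P A" "modulus (restrict_vec A u) = polymatroid_rank P A"
      by (simp_all add: u(2) modulus_restrict_vec) (simp add: weight_def restrict_vec_def)
  qed (simp add: restrict_vec_def)
qed

text \<open>
  A vector attaining the rank of \<open>A \<inter> B\<close> can be augmented to one attaining the rank of \<open>A \<union> B\<close>. This
  single element of \<open>P\<close> attains both ranks on the left, and the right-hand side bounds its weights on
  \<open>A\<close> and \<open>B\<close>.
\<close>

lemma rank_submodular:
  "polymatroid_rank P (A \<union> B) + polymatroid_rank P (A \<inter> B) \<le> polymatroid_rank P A + polymatroid_rank P B"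
proof -
  obtain u where u: "u \<in> P" "weight (A \<inter> B) u = polymatroid_rank P (A \<inter> B)" "\<And>j. j \<notin> A \<inter> B \<Longrightarrow> u $ j = 0"
    by (rule rank_attained) blast
  obtain x where x: "x \<in> P" "\<And>j. j \<notin> A \<union> B \<Longrightarrow> x $ j = 0" "modulus x = polymatroid_rank P (A \<union> B)"
    by (rule rank_attained) blast
  obtain w where w: "w \<in> P" "u \<le> w" "w \<le> join u x" "modulus x \<le> modulus w"
    using u(1) x(1) by (rule polymatroid_augment_fully)
  have "w $ j = 0" if "j \<notin> A \<union> B" for j
  proof -
    have "w $ j \<le> join u x $ j"
      using w(3) by (simp add: less_eq_vec_def)
    then show ?thesis
      using u(3)[of j] x(2)[of j] that by (simp add: join_def)
  qed
  then have "modulus w = weight (A \<union> B) w"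
    by (rule modulus_eq_weight)
  then have "polymatroid_rank P (A \<union> B) \<le> weight (A \<union> B) w"
    using w(4) x(3) by simp
  moreover have "polymatroid_rank P (A \<inter> B) \<le> weight (A \<inter> B) w"
    using weight_mono[OF w(2), of "A \<inter> B"] u(2) by simp
  moreover have "weight (A \<union> B) w + weight (A \<inter> B) w = weight A w + weight B w"
    unfolding weight_def by (rule sum.union_inter) auto
  ultimately show ?thesis
    using weight_le_rank[OF w(1), of A] weight_le_rank[OF w(1), of B] by simp
qed

lemma rank_mono: "A \<subseteq> B \<Longrightarrow> polymatroid_rank P A \<le> polymatroid_rank P B"
proof -
  assume "A \<subseteq> B"
  obtain u where u: "u \<in> P" "weight A u = polymatroid_rank P A"
    by (rule rank_attained) blast
  then show ?thesis
    using weight_le_rank[OF u(1), of B] sum_mono2[OF _ \<open>A \<subseteq> B\<close>, of "\<lambda>j. u $ j"]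
    by (simp add: weight_def)
qed

text \<open>
  The factor \<open>n\<close> is there because a sum of \<open>n\<close> elements of \<open>P\<close> is bounded by \<open>n\<close> times the rank function.
\<close>

lemma rank_polymatroid_function: "polymatroid_function (\<lambda>A. int n * int (polymatroid_rank P A))"
proof -
  have "int n * int (polymatroid_rank P (A \<union> B)) + int n * int (polymatroid_rank P (A \<inter> B))
      \<le> int n * int (polymatroid_rank P A) + int n * int (polymatroid_rank P B)" for A B
    using rank_submodular[of A B] by (simp flip: distrib_left of_nat_add of_nat_mult)
  moreover have "polymatroid_rank P {} = 0"
  proof -
    obtain u where "u \<in> P" "weight {} u = polymatroid_rank P {}"
      by (rule rank_attained) blast
    then show ?thesis
      by (simp add: weight_def)
  qed
  ultimately show ?thesis
    using rank_mono by (auto simp: polymatroid_function_def mono_def intro!: mult_left_mono)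
qed

text \<open>
  \<open>T\<close> consists of the indices at which \<open>u\<close> cannot be increased within \<open>P\<close>. If \<open>u\<close> did not attain the rank
  of \<open>T\<close>, its restriction to \<open>T\<close> could be increased at some \<open>j \<in> T\<close>. Augmenting the result by \<open>u\<close> gives a
  \<open>y \<in> P\<close> that differs from \<open>u + axis j 1\<close> by a single unit lost at an index \<open>k \<notin> T\<close>. As \<open>u + axis k 1\<close> is in
  \<open>P\<close>, exchanging \<open>y\<close> with it can only restore the lost unit, which puts \<open>u + axis j 1\<close> into \<open>P\<close>, against
  \<open>j \<in> T\<close>.
\<close>

lemma saturated_set_tight:
  assumes u: "u \<in> P" and T: "T = {j. u + axis j 1 \<notin> P}"
  shows "weight T u = polymatroid_rank P T"
proof (rule ccontr)
  assume neq: "weight T u \<noteq> polymatroid_rank P T"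
  define u' where "u' = restrict_vec T u"
  have u': "u' \<in> P" "u' \<le> u"
    unfolding u'_def using u restrict_vec_le polymatroid_downward by auto
  obtain x where x: "x \<in> P" "\<And>j. j \<notin> T \<Longrightarrow> x $ j = 0" "modulus x = polymatroid_rank P T"
    by (rule rank_attained) blast
  have "modulus u' < modulus x"
    using neq weight_le_rank[OF u, of T] x(3) by (simp add: u'_def modulus_restrict_vec)
  then obtain w where w: "w \<in> P" "u' < w" "w \<le> join u' x"
    using polymatroid_augment[OF u'(1) x(1)] by blast
  obtain j where j: "u' \<le> w" "u' $ j < w $ j"
    using w(2) by (rule strict_vecE)
  have "j \<in> T"
  proof (rule ccontr)
    assume "j \<notin> T"
    then have "join u' x $ j = 0"
      using x(2) by (simp add: join_def u'_def restrict_vec_def)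
    then show False
      using j(2) w(3) by (metis bot_nat_0.extremum_strict le_zero_eq less_eq_vec_def)
  qed
  have "u' + axis j 1 \<le> w"
    using j by (auto simp: less_eq_vec_def axis_def)
  then have "u' + axis j 1 \<in> P"
    using w(1) polymatroid_downward by blast
  then obtain y where y: "y \<in> P" "u' + axis j 1 \<le> y" "y \<le> join (u' + axis j 1) u" "modulus u \<le> modulus y"
    using u by (rule polymatroid_augment_fully)
  have nuj: "u + axis j 1 \<notin> P"
    using \<open>j \<in> T\<close> T by simp
  have y_le_at: "y $ i \<le> (u + axis j 1) $ i" for i
  proof -
    have "y $ i \<le> join (u' + axis j 1) u $ i" "u' $ i \<le> u $ i"
      using y(3) u'(2) by (auto simp: less_eq_vec_def)
    then show ?thesis
      by (auto simp: join_def)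
  qed
  then have y_le: "y \<le> u + axis j 1"
    by (simp add: less_eq_vec_def)
  moreover have "y \<noteq> u + axis j 1"
    using y(1) nuj by auto
  ultimately have "y < u + axis j 1"
    by simp
  then obtain k where k: "y $ k < (u + axis j 1) $ k"
    by (rule strict_vecE)
  have y_T: "(u + axis j 1) $ i \<le> y $ i" if "i \<in> T" for i
  proof -
    have "(u' + axis j 1) $ i \<le> y $ i"
      using y(2) by (simp only: less_eq_vec_def)
    then show ?thesis
      using that by (simp add: u'_def restrict_vec_def)
  qed
  then have "k \<notin> T"
    using k by (meson not_le)
  then have kj: "k \<noteq> j" and uk: "u + axis k 1 \<in> P"
    using \<open>j \<in> T\<close> T by auto
  have modulus_axis: "modulus (v + axis i 1) = modulus v + 1" for v :: "nat ^ 'n" and i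
    by (simp add: modulus_def sum.distrib axis_def)
  have y_eq: "y + axis k 1 = u + axis j 1"
  proof (rule ccontr)
    assume "\<not> ?thesis"
    moreover have "(y + axis k 1) $ i \<le> (u + axis j 1) $ i" for i
      using y_le_at[of i] k by (cases "i = k") (simp_all add: axis_def)
    ultimately have "y + axis k 1 < u + axis j 1"
      by (simp add: order.strict_iff_order less_eq_vec_def)
    then have "modulus (y + axis k 1) < modulus (u + axis j 1)"
      by (rule modulus_strict_mono)
    then show False
      using y(4) by (simp only: modulus_axis)
  qed
  have y_other: "y $ i = (u + axis j 1) $ i" if "i \<noteq> k" for i
    using arg_cong[OF y_eq, of "\<lambda>v. v $ i"] that by (simp add: axis_def)
  have yk: "u $ k = y $ k + 1"
    using arg_cong[OF y_eq, of "\<lambda>v. v $ k"] kj by (simp add: axis_def)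
  have "modulus y < modulus (u + axis k 1)"
    using modulus_strict_mono[OF \<open>y < u + axis j 1\<close>] by (simp only: modulus_axis)
  then obtain z where z: "z \<in> P" "y < z" "z \<le> join y (u + axis k 1)"
    using polymatroid_augment[OF y(1) uk] by blast
  obtain i where i: "y \<le> z" "y $ i < z $ i"
    using z(2) by (rule strict_vecE)
  have "i = k"
  proof (rule ccontr)
    assume "i \<noteq> k"
    then have "join y (u + axis k 1) $ i = y $ i"
      using y_other[of i] by (simp add: join_def axis_def)
    then show False
      using i(2) z(3) by (metis less_eq_vec_def not_le)
  qed
  have "(u + axis j 1) $ l \<le> z $ l" for l
  proof (cases "l = k")
    case True
    then show ?thesis
      using i(2) \<open>i = k\<close> yk kj by (simp add: axis_def)
  next
    case False
    then show ?thesis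
      using i(1) y_other[OF False] unfolding less_eq_vec_def by metis
  qed
  then have "u + axis j 1 \<le> z"
    by (simp add: less_eq_vec_def)
  then show False
    using nuj z(1) polymatroid_downward by blast
qed

text \<open>
  Take a maximal \<open>u \<in> P\<close> below \<open>a\<close>. Wherever \<open>u\<close> is smaller than \<open>a\<close> it is saturated, so on the saturated
  set \<open>a\<close> would exceed \<open>u\<close> and with it the rank.
\<close>

theorem mem_polymatroid_iff: "a \<in> P \<longleftrightarrow> (\<forall>A. weight A a \<le> polymatroid_rank P A)"
proof
  assume a: "\<forall>A. weight A a \<le> polymatroid_rank P A"
  obtain x where "x \<in> P"
    using polymatroid_nonempty by auto
  then have "0 \<in> P"
    by (rule polymatroid_downward) (simp add: less_eq_vec_def)
  then obtain u where u: "u \<in> P" "u \<le> a" "\<And>v. v \<in> P \<Longrightarrow> v \<le> a \<Longrightarrow> modulus v \<le> modulus u"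
    using polymatroid_maximal[of 0 "\<lambda>v. v \<le> a"] by (metis less_eq_vec_def zero_index zero_le)
  define T where "T = {j. u + axis j 1 \<notin> P}"
  show "a \<in> P"
  proof (rule ccontr)
    assume "a \<notin> P"
    then have "u < a"
      using u by (metis order_le_less)
    then obtain j where j: "u $ j < a $ j"
      by (rule strict_vecE)
    have "u + axis j 1 \<le> a"
      using u(2) j by (auto simp: less_eq_vec_def axis_def)
    moreover have "modulus u < modulus (u + axis j 1)"
      by (simp add: modulus_def sum.distrib axis_def)
    ultimately have "j \<in> T"
      using u(3)[of "u + axis j 1"] by (auto simp: T_def)
    then have "weight T u < weight T a"
      using weight_strict_mono[OF u(2) _ j] by blast
    then show False
      using saturated_set_tight[OF u(1) T_def] a by (metis not_le)
  qed
qed (use weight_le_rank in blast)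

theorem integer_decomposition:
  assumes "\<And>A. weight A u \<le> i * polymatroid_rank P A"
  shows "\<exists>us. length us = i \<and> set us \<subseteq> P \<and> sum_list us = u"
  using assms
proof (induction i arbitrary: u)
  case 0
  have "u $ j = 0" for j
    using 0[of "{j}"] by (simp add: weight_def)
  then show ?case
    by (simp add: vec_eq_iff)
next
  case (Suc i)
  have "sum (\<lambda>j. int (u $ j)) A \<le> int 1 * int (polymatroid_rank P A) + int i * int (polymatroid_rank P A)" for A
    using Suc.prems[of A] by (simp add: weight_def flip: of_nat_sum of_nat_add of_nat_mult)
  then obtain v where v: "\<And>j. 0 \<le> v j \<and> v j \<le> int (u $ j)"
    "\<And>A. sum v A \<le> int 1 * int (polymatroid_rank P A)"
    "\<And>A. sum (\<lambda>j. int (u $ j) - v j) A \<le> int i * int (polymatroid_rank P A)"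
    using polymatroid_splitting[OF finite[of "UNIV :: 'n set"] rank_polymatroid_function[of 1]
        rank_polymatroid_function[of i], where u = "\<lambda>j. int (u $ j)"] by auto
  define x y where "x = (\<chi> j. nat (v j))" and "y = (\<chi> j. u $ j - nat (v j))"
  have v_eq: "v = (\<lambda>j. int (x $ j))" "(\<lambda>j. int (u $ j) - v j) = (\<lambda>j. int (y $ j))"
    using v(1) by (auto simp: x_def y_def fun_eq_iff of_nat_diff nat_le_iff)
  have "weight A x \<le> polymatroid_rank P A" for A
    using v(2)[of A] by (simp add: v_eq(1) weight_def flip: of_nat_sum)
  then have "x \<in> P"
    by (simp add: mem_polymatroid_iff)
  have "weight A y \<le> i * polymatroid_rank P A" for A
    using v(3)[of A] unfolding v_eq(2) by (simp add: weight_def flip: of_nat_sum of_nat_mult)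
  then obtain us where "length us = i" "set us \<subseteq> P" "sum_list us = y"
    using Suc.IH by blast
  moreover have "x + y = u"
    using v(1) by (simp add: x_def y_def vec_eq_iff nat_le_iff)
  ultimately show ?case
    using \<open>x \<in> P\<close> by (intro exI[of _ "x # us"]) simp
qed

text \<open>
  The inequality for \<open>A\<close> describes a half-space, which contains \<open>P\<close> and therefore its convex hull, and it
  scales with the last coordinate of the cone.
\<close>

lemma cone_weight_le:
  assumes "(real_vec u, real i) \<in> cone_over (convex hull (real_vec ` P))"
  shows "weight A u \<le> i * polymatroid_rank P A"
proof -
  obtain p where p: "p \<in> convex hull (real_vec ` P)" "real_vec u = real i *\<^sub>R p"
    using assms by (auto simp: cone_over_def)
  let ?H = "{p :: real ^ 'n. (\<Sum>j\<in>A. p $ j) \<le> real (polymatroid_rank P A)}"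
  have "convex ?H"
  proof (rule convexI)
    fix x y :: "real ^ 'n" and s t :: real
    assume "x \<in> ?H" "y \<in> ?H" and st: "0 \<le> s" "0 \<le> t" "s + t = 1"
    then have "s * (\<Sum>j\<in>A. x $ j) + t * (\<Sum>j\<in>A. y $ j) \<le> real (polymatroid_rank P A)"
      by (intro convex_bound_le) auto
    then show "s *\<^sub>R x + t *\<^sub>R y \<in> ?H"
      by (simp add: sum.distrib sum_distrib_left)
  qed
  moreover have "real_vec ` P \<subseteq> ?H"
    using weight_le_rank[of _ A] by (auto simp: real_vec_def weight_def simp flip: of_nat_sum)
  ultimately have "p \<in> ?H"
    using p(1) hull_minimal[of "real_vec ` P" ?H convex] by blast
  then have "real i * (\<Sum>j\<in>A. p $ j) \<le> real i * real (polymatroid_rank P A)"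
    by (intro mult_left_mono) auto
  moreover have "real (weight A u) = real i * (\<Sum>j\<in>A. p $ j)"
  proof -
    have "real (u $ j) = real i * p $ j" for j
      using arg_cong[OF p(2), of "\<lambda>v. v $ j"] by (simp add: real_vec_def)
    then show ?thesis
      by (simp add: weight_def sum_distrib_left)
  qed
  ultimately show ?thesis
    by (simp flip: of_nat_mult)
qed

end

section \<open>Monomials and the monoid of their exponents\<close>

definition monom_exp :: "nat ^ 'n \<Rightarrow> nat \<Rightarrow> 'n option \<Rightarrow>\<^sub>0 nat" where
  "monom_exp u i = (\<Sum>j\<in>UNIV. Poly_Mapping.single (Some j) (u $ j)) + Poly_Mapping.single None i"

lemma lookup_monom_exp [simp]:
  "Poly_Mapping.lookup (monom_exp u i) (Some j) = u $ j"
  "Poly_Mapping.lookup (monom_exp u i) None = i"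
  by (simp_all add: monom_exp_def lookup_add lookup_sum lookup_single when_def)

lemma monom_exp_lookup:
  "monom_exp (\<chi> j. Poly_Mapping.lookup e (Some j)) (Poly_Mapping.lookup e None) = e"
proof (rule poly_mapping_eqI)
  show "Poly_Mapping.lookup (monom_exp (\<chi> j. Poly_Mapping.lookup e (Some j)) (Poly_Mapping.lookup e None)) k
      = Poly_Mapping.lookup e k" for k
    by (cases k) simp_all
qed

lemma indet_power: "indet x ^ k = Poly_Mapping.single (Poly_Mapping.single x k) 1"
  by (induction k) (simp_all add: indet_def mult_single flip: single_add)

lemma prod_single:
  "(\<Prod>j\<in>A. Poly_Mapping.single (e j) (1 :: 'k::field)) =
    Poly_Mapping.single (\<Sum>j\<in>A. e j :: 'e::comm_monoid_add) 1"
  by (induction A rule: infinite_finite_induct) (simp_all add: mult_single)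

lemma ts_monom_eq_single: "ts_monom u i = Poly_Mapping.single (monom_exp u i) 1"
  by (simp add: ts_monom_def indet_power prod_single mult_single monom_exp_def)

lemma ts_monom_add: "ts_monom (u + v) (i + k) = ts_monom u i * ts_monom v k"
  by (simp add: ts_monom_def power_add prod.distrib mult_ac)

lemma is_subalgebra_generated: "is_subalgebra (generated_subalgebra G)"
  unfolding generated_subalgebra_def
  by (rule hull_in) (force simp: is_subalgebra_def)

text \<open>
  For a discrete polymatroid \<open>P\<close> these are the lattice points of the cone over its convex hull, with the
  pair \<open>(u, i)\<close> encoded as an exponent vector.
\<close>

definition rank_monoid :: "(nat ^ 'n) set \<Rightarrow> ('n option \<Rightarrow>\<^sub>0 nat) set" where
  "rank_monoid P = {e. \<forall>A. (\<Sum>j\<in>A. Poly_Mapping.lookup e (Some j)) \<le> Poly_Mapping.lookup e None * polymatroid_rank P A}"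

lemma monom_exp_in_rank_monoid:
  "monom_exp u i \<in> rank_monoid P \<longleftrightarrow> (\<forall>A. weight A u \<le> i * polymatroid_rank P A)"
  by (simp add: rank_monoid_def weight_def)

lemma zero_in_rank_monoid: "0 \<in> rank_monoid P"
  by (simp add: rank_monoid_def)

lemma rank_monoid_add: "x \<in> rank_monoid P \<Longrightarrow> y \<in> rank_monoid P \<Longrightarrow> x + y \<in> rank_monoid P"
  by (auto simp: rank_monoid_def lookup_add sum.distrib add_mult_distrib intro: add_mono)

lemma lookup_funpow_add:
  "Poly_Mapping.lookup (((+) \<alpha> ^^ k) s) x = k * Poly_Mapping.lookup \<alpha> x + Poly_Mapping.lookup s x"
  for \<alpha> s :: "'a \<Rightarrow>\<^sub>0 nat"
  by (induction k) (simp_all add: lookup_add)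

lemma archimedean_nat_le:
  assumes "\<And>k::nat. k * p \<le> k * q + r"
  shows "p \<le> (q::nat)"
proof (rule ccontr)
  assume "\<not> p \<le> q"
  then have "Suc r * Suc q \<le> Suc r * p"
    by (intro mult_left_mono) auto
  then show False
    using assms[of "Suc r"] by simp
qed

text \<open>
  Membership is given by linear inequalities, nonnegativity of the entries included. Along the
  points \<open>s + k (\<alpha> - \<beta>)\<close> a linear form stays nonnegative for all \<open>k\<close> only if it is nonnegative at \<open>\<alpha> - \<beta>\<close>.
\<close>

lemma rank_monoid_completely_closed:
  fixes P :: "(nat ^ 'n) set"
  assumes c: "\<And>k. \<exists>c\<in>rank_monoid P. ((+) \<alpha> ^^ k) s = ((+) \<beta> ^^ k) c"
  shows "\<exists>\<gamma>\<in>rank_monoid P. \<alpha> = \<gamma> + \<beta>"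
proof -
  let ?l = Poly_Mapping.lookup
  obtain c where c: "\<And>k. c k \<in> rank_monoid P" "\<And>k. ((+) \<alpha> ^^ k) s = ((+) \<beta> ^^ k) (c k)"
    using c by metis
  have eq: "k * ?l \<alpha> x + ?l s x = k * ?l \<beta> x + ?l (c k) x" for k x
    using arg_cong[OF c(2)[of k], of "\<lambda>f. ?l f x"] by (simp add: lookup_funpow_add)
  have le: "?l \<beta> x \<le> ?l \<alpha> x" for x
  proof (rule archimedean_nat_le)
    show "k * ?l \<beta> x \<le> k * ?l \<alpha> x + ?l s x" for k
      using eq[of k x] by simp
  qed
  define \<gamma> where "\<gamma> = \<alpha> - \<beta>"
  have \<gamma>: "?l \<alpha> x = ?l \<gamma> x + ?l \<beta> x" for x
    using le[of x] by (simp add: \<gamma>_def lookup_minus)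
  have ck: "?l (c k) x = k * ?l \<gamma> x + ?l s x" for k x
    using eq[of k x] by (simp add: \<gamma> algebra_simps)
  have "(\<Sum>j\<in>A. ?l \<gamma> (Some j)) \<le> ?l \<gamma> None * polymatroid_rank P A" for A
  proof (rule archimedean_nat_le)
    fix k
    have "(\<Sum>j\<in>A. ?l (c k) (Some j)) \<le> ?l (c k) None * polymatroid_rank P A"
      using c(1)[of k] by (simp add: rank_monoid_def)
    then show "k * (\<Sum>j\<in>A. ?l \<gamma> (Some j)) \<le> k * (?l \<gamma> None * polymatroid_rank P A) + ?l s None * polymatroid_rank P A"
      by (simp add: ck sum.distrib sum_distrib_left add_mult_distrib)
  qed
  then have "\<gamma> \<in> rank_monoid P"
    by (simp add: rank_monoid_def)
  moreover have "\<alpha> = \<gamma> + \<beta>"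
    by (rule poly_mapping_eqI) (simp add: lookup_add \<gamma>)
  ultimately show ?thesis
    by blast
qed

section \<open>The polymatroid ring and the Ehrhart ring\<close>

lemma polymatroid_ring_subset_ehrhart_ring:
  "polymatroid_ring P \<subseteq> ehrhart_ring (convex hull (real_vec ` P))"
  unfolding polymatroid_ring_def ehrhart_ring_def generated_subalgebra_def
proof (rule hull_mono, safe)
  fix u assume "u \<in> P"
  then have "(real_vec u, real 1) \<in> cone_over (convex hull (real_vec ` P))"
    by (auto simp: cone_over_def intro!: exI[of _ 1] hull_inc)
  then show "\<exists>v i. ts_monom u 1 = ts_monom v i \<and> (real_vec v, real i) \<in> cone_over (convex hull (real_vec ` P))"
    by blast
qed

lemma is_subalgebra_monoid_algebra: "is_subalgebra (monoid_algebra (rank_monoid P))"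
  unfolding is_subalgebra_def
  by (auto simp: const_def zero_in_rank_monoid
      intro!: monoid_algebra_single monoid_algebra_add monoid_algebra_mult rank_monoid_add)

lemma ehrhart_ring_subset_monoid_algebra:
  assumes "discrete_polymatroid P"
  shows "ehrhart_ring (convex hull (real_vec ` P)) \<subseteq> monoid_algebra (rank_monoid P)"
  unfolding ehrhart_ring_def generated_subalgebra_def
proof (rule hull_minimal)
  show "is_subalgebra (monoid_algebra (rank_monoid P))"
    by (rule is_subalgebra_monoid_algebra)
  show "{ts_monom u i |u i. (real_vec u, real i) \<in> cone_over (convex hull (real_vec ` P))}
      \<subseteq> monoid_algebra (rank_monoid P)"
  proof safe
    fix u i assume "(real_vec u, real i) \<in> cone_over (convex hull (real_vec ` P))"
    then have "monom_exp u i \<in> rank_monoid P"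
      using cone_weight_le[OF assms] by (simp add: monom_exp_in_rank_monoid)
    then show "ts_monom u i \<in> monoid_algebra (rank_monoid P)"
      by (simp add: ts_monom_eq_single monoid_algebra_single)
  qed
qed

lemma polymatroid_ring_closed:
  fixes f g :: "('n::finite, 'k::field) ts_poly"
  shows "const c \<in> (polymatroid_ring P :: ('n, 'k) ts_poly set)"
    and "f \<in> polymatroid_ring P \<Longrightarrow> g \<in> polymatroid_ring P \<Longrightarrow> f + g \<in> polymatroid_ring P"
    and "f \<in> polymatroid_ring P \<Longrightarrow> g \<in> polymatroid_ring P \<Longrightarrow> f * g \<in> polymatroid_ring P"
proof -
  have "is_subalgebra (polymatroid_ring P :: ('n, 'k) ts_poly set)"
    by (simp add: polymatroid_ring_def is_subalgebra_generated)
  then show "const c \<in> (polymatroid_ring P :: ('n, 'k) ts_poly set)"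
    "f \<in> polymatroid_ring P \<Longrightarrow> g \<in> polymatroid_ring P \<Longrightarrow> f + g \<in> polymatroid_ring P"
    "f \<in> polymatroid_ring P \<Longrightarrow> g \<in> polymatroid_ring P \<Longrightarrow> f * g \<in> polymatroid_ring P"
    unfolding is_subalgebra_def by blast+
qed

lemma sum_list_ts_monom_in_polymatroid_ring:
  fixes P :: "(nat ^ 'n) set"
  shows "set us \<subseteq> P \<Longrightarrow> ts_monom (sum_list us) (length us) \<in> (polymatroid_ring P :: ('n, 'k::field) ts_poly set)"
proof (induction us)
  case Nil
  have "ts_monom 0 0 = (const 1 :: ('n, 'k) ts_poly)"
    by (simp add: ts_monom_def const_def)
  then show ?case
    by (simp add: polymatroid_ring_closed)
next
  case (Cons u us)
  have "ts_monom u 1 \<in> (polymatroid_ring P :: ('n, 'k) ts_poly set)"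
    using Cons.prems unfolding polymatroid_ring_def generated_subalgebra_def
    by (intro hull_inc) auto
  moreover have "ts_monom (sum_list (u # us)) (length (u # us)) =
      (ts_monom u 1 * ts_monom (sum_list us) (length us) :: ('n, 'k) ts_poly)"
    by (simp flip: ts_monom_add)
  ultimately show ?case
    using Cons by (simp add: polymatroid_ring_closed)
qed

lemma monoid_algebra_subset_polymatroid_ring:
  fixes P :: "(nat ^ 'n) set"
  assumes "discrete_polymatroid P"
  shows "monoid_algebra (rank_monoid P) \<subseteq> polymatroid_ring P"
proof
  fix f :: "('n, 'k::field) ts_poly"
  assume f: "f \<in> monoid_algebra (rank_monoid P)"
  let ?A = "polymatroid_ring P :: ('n, 'k) ts_poly set"
  have "Poly_Mapping.single e c \<in> ?A" if "e \<in> rank_monoid P" for e c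
  proof -
    let ?u = "\<chi> j. Poly_Mapping.lookup e (Some j)" and ?i = "Poly_Mapping.lookup e None"
    have "\<forall>A. weight A ?u \<le> ?i * polymatroid_rank P A"
      using that monom_exp_in_rank_monoid[of ?u ?i P] by (simp add: monom_exp_lookup)
    then obtain us where "length us = ?i" "set us \<subseteq> P" "sum_list us = ?u"
      using integer_decomposition[OF assms] by blast
    then have "ts_monom ?u ?i \<in> ?A"
      using sum_list_ts_monom_in_polymatroid_ring[of us P] by simp
    moreover have "Poly_Mapping.single e c = const c * ts_monom ?u ?i"
      by (simp add: ts_monom_eq_single monom_exp_lookup const_def mult_single)
    ultimately show ?thesis
      by (simp add: polymatroid_ring_closed)
  qed
  then have "(\<Sum>e\<in>Poly_Mapping.keys f. Poly_Mapping.single e (Poly_Mapping.lookup f e)) \<in> ?A"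
    using f polymatroid_ring_closed(1)[of 0 P]
    by (intro sum_closed polymatroid_ring_closed(2)) (auto simp: monoid_algebra_def const_def)
  then show "f \<in> ?A"
    by (simp flip: poly_mapping_sum_singles)
qed

theorem theorem6p1:
  fixes P :: "(nat ^ 'n::{finite,linorder}) set"
  assumes "discrete_polymatroid P"
  shows "((polymatroid_ring P :: ('n, 'k::field) ts_poly set)
           = ehrhart_ring (convex hull (real_vec ` P)))
         \<and> normal_subring (polymatroid_ring P :: ('n, 'k) ts_poly set)"
proof -
  have "polymatroid_ring P = (monoid_algebra (rank_monoid P) :: ('n, 'k) ts_poly set)"
    "polymatroid_ring P = (ehrhart_ring (convex hull (real_vec ` P)) :: ('n, 'k) ts_poly set)"
    using polymatroid_ring_subset_ehrhart_ring ehrhart_ring_subset_monoid_algebra[OF assms]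
      monoid_algebra_subset_polymatroid_ring[OF assms] by blast+
  moreover have "normal_subring (monoid_algebra (rank_monoid P) :: ('n, 'k) ts_poly set)"
    by (rule normal_monoid_algebra[OF wf_lex_poly_mapping zero_in_rank_monoid rank_monoid_add
          rank_monoid_completely_closed])
  ultimately show ?thesis
    by simp
qed

end
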